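(* Let $\gamma\ge 0$, $C\ge 0$ and $\lambda>G/\rho$, and let $h_\gamma:\mathbb{R}^d\to\mathbb{R}$ be a penalty function satisfying $$h_\gamma(\mathbf{x})\ge \lambda[c(\mathbf{x})]_+\ \ \forall \mathbf{x}\in\mathbb{R}^d,\qquad h_\gamma(\mathbf{x})\le C\gamma\ \ \forall \mathbf{x}\text{ such that }c(\mathbf{x})\le 0 .$$ Put $F_\gamma(\mathbf{x})=f(\mathbf{x})+h_\gamma(\mathbf{x})$. Let $\mathcal{A}$ be any (deterministic) iterative optimization algorithm applied to $\min_{\mathbf{x}\in\mathbb{R}^d}F_\gamma(\mathbf{x})$ with $T$ iterations, which starts with $\mathbf{x}_1$ and returns $\widehat{\mathbf{x}}_T$ as the final solution, such that for any $\mathbf{x}\in\mathbb{R}^d$ $$F_\gamma(\widehat{\mathbf{x}}_T)-F_\gamma(\mathbf{x})\le B_T(\gamma;\mathbf{x},\mathbf{x}_1),$$ where $B_T(\gamma;\mathbf{x},\mathbf{x}_1)\to 0$ as $T\to\infty$. Suppose that Assumption 1 (stated in the context) holds. Then $$f(\widetilde{\mathbf{x}}_T)-f(\mathbf{x}_* )\le \frac{\lambda\rho}{\lambda\rho-G}\bigl(C\gamma+B_T(\gamma;\mathbf{x}_*,\mathbf{x}_1)\bigr),$$ where $\widetilde{\mathbf{x}}_T=\Pi_\Omega[\widehat{\mathbf{x}}_T]$ and $\mathbf{x}_*$ is an optimal solution to $\min\{f(\mathbf{x}):c(\mathbf{x})\le 0\}$.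
   Context: The problem is $\min_{\mathbf{x}\in\mathbb{R}^d} f(\mathbf{x})$ subject to $c(\mathbf{x})\le 0$, with $f$ convex (smooth or non-smooth) and $c$ lower-semicontinuous and convex. $\Omega=\{\mathbf{x}\in\mathbb{R}^d:c(\mathbf{x})\le 0\}$; $\|\cdot\|$ is the Euclidean norm; $\Pi_\Omega[\mathbf{x}]=\arg\min_{\mathbf{u}\in\Omega}\|\mathbf{u}-\mathbf{x}\|^2$; $[s]_+=\max(s,0)$. Assumption 1: (i) there exists $\rho>0$ such that $\min\{\|\mathbf{v}\|: c(\mathbf{x})=0,\ \mathbf{v}\in\partial c(\mathbf{x}),\ \mathbf{v}\ne 0\}\ge\rho$, or, more generally, there exists $\rho>0$ such that for every $\mathbf{x}\in\mathbb{R}^d$ the point $\mathbf{x}^\natural=\Pi_\Omega[\mathbf{x}]$ satisfies $\|\mathbf{x}^\natural-\mathbf{x}\|\le [c(\mathbf{x})]_+/\rho$ (the first condition implies the second with the same $\rho$); (ii) there exists $\mathbf{x}$ with $c(\mathbf{x})<0$; (iii) $f$ and $c$ are defined everywhere on $\mathbb{R}^d$ and are Lipschitz continuous with Lipschitz constants $G$ and $G_c$, respectively. *)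

theory Defs
  imports "HOL-Analysis.Analysis"
begin

definition lower_semicontinuous :: "('a::topological_space \<Rightarrow> real) \<Rightarrow> bool" where
  "lower_semicontinuous c \<longleftrightarrow> (\<forall>x. \<forall>a < c x. \<forall>\<^sub>F y in nhds x. a < c y)"

definition subdifferential :: "('a::real_inner \<Rightarrow> real) \<Rightarrow> 'a \<Rightarrow> 'a set" where
  "subdifferential c x = {v. \<forall>y. c x + v \<bullet> (y - x) \<le> c y}"

definition feasible_set :: "('a \<Rightarrow> real) \<Rightarrow> 'a set" where
  "feasible_set c = {x. c x \<le> 0}"

definition positive_part :: "real \<Rightarrow> real" where
  "positive_part s = max s 0"

definition penalized :: "('a \<Rightarrow> real) \<Rightarrow> (real \<Rightarrow> 'a \<Rightarrow> real) \<Rightarrow> real \<Rightarrow> 'a \<Rightarrow> real" where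
  "penalized f h \<gamma> x = f x + h \<gamma> x"

text \<open>The condition that the minimum of the norms of the nonzero subgradients of \<open>c\<close> over its
  zero level set is at least \<open>\<rho>\<close>, with the minimum over the empty set read as infinity.\<close>

definition subgradients_bounded_below :: "('a::real_inner \<Rightarrow> real) \<Rightarrow> real \<Rightarrow> bool" where
  "subgradients_bounded_below c \<rho> \<longleftrightarrow>
     (\<forall>x v. c x = 0 \<longrightarrow> v \<in> subdifferential c x \<longrightarrow> v \<noteq> 0 \<longrightarrow> \<rho> \<le> norm v)"

definition projection_error_bound :: "('a::euclidean_space \<Rightarrow> real) \<Rightarrow> real \<Rightarrow> bool" where
  "projection_error_bound c \<rho> \<longleftrightarrow>
     (\<forall>x. norm (closest_point (feasible_set c) x - x) \<le> positive_part (c x) / \<rho>)"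

text \<open>A deterministic iterative algorithm. Both components see the objective and the total number
  of iterations (so that, for instance, step sizes may depend on the horizon), together with all
  iterates so far, in chronological order. Since the algorithm is deterministic, the history
  also determines any internal state, such as auxiliary sequences.\<close>

record 'a iterative_algorithm =
  update :: "('a \<Rightarrow> real) \<Rightarrow> nat \<Rightarrow> 'a list \<Rightarrow> 'a"
  final_solution :: "('a \<Rightarrow> real) \<Rightarrow> nat \<Rightarrow> 'a list \<Rightarrow> 'a"

primrec iterates :: "'a iterative_algorithm \<Rightarrow> ('a \<Rightarrow> real) \<Rightarrow> nat \<Rightarrow> 'a \<Rightarrow> nat \<Rightarrow> 'a list" where
  "iterates A F T x1 0 = [x1]"
| "iterates A F T x1 (Suc t) =
     iterates A F T x1 t @ [update A F T (iterates A F T x1 t)]"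

definition run :: "'a iterative_algorithm \<Rightarrow> ('a \<Rightarrow> real) \<Rightarrow> nat \<Rightarrow> 'a \<Rightarrow> 'a" where
  "run A F T x1 = final_solution A F T (iterates A F T x1 T)"

end

theory Submission
  imports Defs
begin

text \<open>The error bound says that \<open>f\<close> loses at most \<open>G / \<rho>\<close> times the constraint violation when a point is
  projected onto the feasible set, while the penalty charges \<open>lam > G / \<rho>\<close> times this violation.
  Under the subgradient condition the error bound holds because, by Slater's condition, the normal
  \<open>x - p\<close> at the projection \<open>p\<close> of an infeasible \<open>x\<close> is a positive multiple of a subgradient \<open>v\<close>
  of \<open>c\<close> at \<open>p\<close>, so that \<open>c x \<ge> v \<bullet> (x - p) = norm v * norm (x - p)\<close>.\<close>

lemma feasible_set_convex_closed:
  fixes c :: "'a::euclidean_space \<Rightarrow> real"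
  assumes "convex_on UNIV c"
  shows "convex (feasible_set c)" and "closed (feasible_set c)"
proof -
  show "convex (feasible_set c)"
  proof (rule convexI)
    fix x y and u v :: real
    assume xy: "x \<in> feasible_set c" "y \<in> feasible_set c" and uv: "0 \<le> u" "0 \<le> v" "u + v = 1"
    then have "c (u *\<^sub>R x + v *\<^sub>R y) \<le> u * c x + v * c y"
      using assms by (simp add: convex_on_def)
    also have "\<dots> \<le> 0"
      using xy uv by (simp add: feasible_set_def add_nonpos_nonpos mult_nonneg_nonpos)
    finally show "u *\<^sub>R x + v *\<^sub>R y \<in> feasible_set c"
      by (simp add: feasible_set_def)
  qed
  have "continuous_on UNIV c"
    using assms convex_on_continuous by blast
  then show "closed (feasible_set c)"
    unfolding feasible_set_def by (intro closed_Collect_le) auto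
qed

text \<open>The multiplier separates the slopes \<open>c y / (n \<bullet> (y - p))\<close> over the two open half-spaces
  bounded by the hyperplane through \<open>p\<close>.\<close>

lemma normal_is_positive_multiple_of_subgradient:
  fixes c :: "'a::euclidean_space \<Rightarrow> real"
  assumes convex: "convex_on UNIV c"
    and slater: "c z < 0"
    and p: "c p \<le> 0"
    and n: "n \<noteq> 0"
    and normal: "\<And>y. c y \<le> 0 \<Longrightarrow> n \<bullet> (y - p) \<le> 0"
  obtains t where "t > 0" and "t *\<^sub>R n \<in> subdifferential c p" and "c p = 0"
proof -
  define s where "s y = n \<bullet> (y - p)" for y
  have cont: "continuous_on UNIV c"
    using convex convex_on_continuous by blast
  \<comment> \<open>If \<open>c y < 0\<close> on the hyperplane, then by continuity \<open>c\<close>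
    stays negative a little further along \<open>n\<close>. There \<open>s\<close> equals
    \<open>e * (n \<bullet> n) > 0\<close>, so a feasible point would violate
    \<open>normal\<close>.\<close>
  have hyperplane: "c y \<ge> 0" if "s y = 0" for y
  proof (rule ccontr)
    assume "\<not> c y \<ge> 0"
    moreover have "((\<lambda>e. c (y + e *\<^sub>R n)) \<longlongrightarrow> c (y + 0 *\<^sub>R n)) (at_right 0)"
      by (intro continuous_on_tendsto_compose[OF cont] tendsto_intros) auto
    ultimately have "\<forall>\<^sub>F e in at_right 0. c (y + e *\<^sub>R n) < 0"
      by (intro order_tendstoD(2)) auto
    then have "\<forall>\<^sub>F e in at_right (0::real). c (y + e *\<^sub>R n) < 0 \<and> e > 0"
      using eventually_at_right_less by (rule eventually_conj)
    then obtain e :: real where e: "c (y + e *\<^sub>R n) < 0" "e > 0"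
      using eventually_happens trivial_limit_at_right_real by blast
    have "n \<bullet> (y + e *\<^sub>R n - p) = e * (n \<bullet> n)"
      using that by (simp add: s_def inner_diff_right inner_add_right)
    moreover have "e * (n \<bullet> n) > 0"
      using e n by simp
    ultimately show False
      using normal[of "y + e *\<^sub>R n"] e by linarith
  qed
  have slopes: "c y / s y \<le> c w / s w" if "s y < 0" "s w > 0" for y w
  proof -
    \<comment> \<open>This weight makes \<open>s\<close> vanish on the segment from \<open>y\<close>
      to \<open>w\<close>. At that crossing point \<open>c\<close> is nonnegative by
      \<open>hyperplane\<close>, and convexity turns this into the comparison of the two
      slopes.\<close>
    define a where "a = - s y / (s w - s y)"
    have a: "0 \<le> a" "a \<le> 1" and a': "1 - a = s w / (s w - s y)"
      using that by (auto simp: a_def field_simps)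
    have "s ((1 - a) *\<^sub>R y + a *\<^sub>R w) = (1 - a) * s y + a * s w"
      by (simp add: s_def algebra_simps inner_diff_right inner_add_right)
    also have "\<dots> = 0"
      unfolding a' by (simp add: a_def)
    finally have "0 \<le> c ((1 - a) *\<^sub>R y + a *\<^sub>R w)"
      by (rule hyperplane)
    also have "\<dots> \<le> (1 - a) * c y + a * c w"
      using convex_onD[OF convex a] by simp
    also have "\<dots> = (s w * c y - s y * c w) / (s w - s y)"
      unfolding a' by (simp add: a_def diff_divide_distrib)
    finally have "0 \<le> s w * c y - s y * c w"
      using that by (simp add: zero_le_divide_iff)
    then show ?thesis
      using that by (simp add: field_simps)
  qed
  \<comment> \<open>The Slater point lies strictly on the negative side. Its slope is positive, so
    it both bounds the infimum below from below and makes it positive.\<close>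
  have z: "s z < 0"
    using normal[of z] hyperplane[of z] slater by (force simp: s_def)
  \<comment> \<open>Any number between the slopes on the negative side and those on the positive
    side would serve; the infimum of the latter is one.\<close>
  define t where "t = (INF w\<in>{w. s w > 0}. c w / s w)"
  have "s (p + n) > 0"
    using n by (simp add: s_def)
  then have nonempty: "{w. s w > 0} \<noteq> {}"
    by blast
  have lower: "c y / s y \<le> t" if "s y < 0" for y
    unfolding t_def using slopes that nonempty by (intro cINF_greatest) auto
  have "bdd_below ((\<lambda>w. c w / s w) ` {w. s w > 0})"
    using slopes z by (intro bdd_belowI2) auto
  then have upper: "t \<le> c w / s w" if "s w > 0" for w
    unfolding t_def using that by (intro cINF_lower) auto
  have "0 < c z / s z"
    using z slater by (simp add: divide_neg_neg)
  then have t: "t > 0"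
    using lower[OF z] by linarith
  have cp: "c p = 0"
    using hyperplane[of p] p by (simp add: s_def)
  \<comment> \<open>Multiplying by \<open>s y\<close> reverses \<open>lower\<close> where
    \<open>s y < 0\<close> and preserves \<open>upper\<close> where \<open>s y > 0\<close>; on the
    hyperplane the claim is \<open>hyperplane\<close> itself.\<close>
  have "t * s y \<le> c y" for y
    using lower[of y] upper[of y] hyperplane[of y]
    by (cases "s y" "0::real" rule: linorder_cases) (simp_all add: field_simps)
  then have "t *\<^sub>R n \<in> subdifferential c p"
    by (simp add: subdifferential_def cp s_def)
  with t cp that show thesis
    by blast
qed

lemma projection_error_bound_if_subgradients_bounded_below:
  fixes c :: "'a::euclidean_space \<Rightarrow> real"
  assumes convex: "convex_on UNIV c"
    and slater: "c z < 0"
    and \<rho>: "\<rho> > 0"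
    and bound: "subgradients_bounded_below c \<rho>"
  shows "projection_error_bound c \<rho>"
  unfolding projection_error_bound_def
proof
  fix x
  define p where "p = closest_point (feasible_set c) x"
  note S = feasible_set_convex_closed[OF convex]
  have "z \<in> feasible_set c"
    using slater by (simp add: feasible_set_def)
  then have p: "c p \<le> 0"
    using closest_point_in_set[OF S(2), of x] by (auto simp: p_def feasible_set_def)
  show "norm (closest_point (feasible_set c) x - x) \<le> positive_part (c x) / \<rho>"
  proof (cases "c x \<le> 0")
    case True
    then show ?thesis
      using \<rho> by (simp add: closest_point_self feasible_set_def positive_part_def)
  next
    case False
    with p have n: "x - p \<noteq> 0"
      by auto
    have normal: "(x - p) \<bullet> (y - p) \<le> 0" if "c y \<le> 0" for y
      using closest_point_dot[OF S, of y x] that by (simp add: p_def feasible_set_def)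
    obtain t where t: "t > 0" "t *\<^sub>R (x - p) \<in> subdifferential c p" "c p = 0"
      using normal_is_positive_multiple_of_subgradient[of c z p "x - p"] convex slater p n normal
      by blast
    then have "\<rho> \<le> norm (t *\<^sub>R (x - p))"
      using bound n unfolding subgradients_bounded_below_def by (metis scaleR_eq_0_iff less_irrefl)
    \<comment> \<open>The subgradient is parallel to \<open>x - p\<close>, so Cauchy-Schwarz holds
      with equality. The subgradient inequality at \<open>p\<close>, where \<open>c\<close>
      vanishes, is then tested at \<open>x\<close>.\<close>
    then have "\<rho> * norm (x - p) \<le> norm (t *\<^sub>R (x - p)) * norm (x - p)"
      by (intro mult_right_mono) auto
    also have "\<dots> = t *\<^sub>R (x - p) \<bullet> (x - p)"
      using t by (simp add: dot_square_norm power2_eq_square)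
    also have "\<dots> \<le> c x"
      using t by (auto simp: subdifferential_def)
    finally show ?thesis
      using \<rho> False by (simp add: p_def positive_part_def norm_minus_commute field_simps)
  qed
qed

theorem theorem1:
  fixes f c :: "real ^ 'd \<Rightarrow> real"
    and h :: "real \<Rightarrow> real ^ 'd \<Rightarrow> real"
    and A :: "(real ^ 'd) iterative_algorithm"
    and B :: "nat \<Rightarrow> real \<Rightarrow> real ^ 'd \<Rightarrow> real ^ 'd \<Rightarrow> real"
    and x1 xopt :: "real ^ 'd"
    and \<gamma> C lam \<rho> G Gc :: real
  assumes f_convex: "convex_on UNIV f"
    and c_convex: "convex_on UNIV c"
    and c_lsc: "lower_semicontinuous c"
    and rho_pos: "\<rho> > 0"
    and error_bound: "subgradients_bounded_below c \<rho> \<or> projection_error_bound c \<rho>"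
    and slater: "\<exists>x. c x < 0"
    and f_lipschitz: "G-lipschitz_on UNIV f"
    and c_lipschitz: "Gc-lipschitz_on UNIV c"
    and gamma_nonneg: "\<gamma> \<ge> 0"
    and C_nonneg: "C \<ge> 0"
    and lambda_gt: "lam > G / \<rho>"
    and h_lower: "\<forall>x. h \<gamma> x \<ge> lam * positive_part (c x)"
    and h_upper: "\<forall>x. c x \<le> 0 \<longrightarrow> h \<gamma> x \<le> C * \<gamma>"
    and convergence: "\<forall>T\<ge>1. \<forall>x.
          penalized f h \<gamma> (run A (penalized f h \<gamma>) T x1) - penalized f h \<gamma> x \<le> B T \<gamma> x x1"
    and B_tendsto_0: "\<forall>x. (\<lambda>T. B T \<gamma> x x1) \<longlonglongrightarrow> 0"
    and xopt_optimal: "is_arg_min f (\<lambda>x. c x \<le> 0) xopt"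
  shows "\<forall>T\<ge>1.
    f (closest_point (feasible_set c) (run A (penalized f h \<gamma>) T x1)) - f xopt
      \<le> lam * \<rho> / (lam * \<rho> - G) * (C * \<gamma> + B T \<gamma> xopt x1)"
proof (intro allI impI)
  fix T :: nat
  assume T: "T \<ge> 1"
  define xh where "xh = run A (penalized f h \<gamma>) T x1"
  define xt where "xt = closest_point (feasible_set c) xh"
  define D where "D = C * \<gamma> + B T \<gamma> xopt x1"
  define r where "r = norm (xt - xh)"
  obtain z where z: "c z < 0"
    using slater by blast
  then have "xt \<in> feasible_set c"
    unfolding xt_def
    by (intro closest_point_in_set feasible_set_convex_closed(2)[OF c_convex])
      (auto simp: feasible_set_def intro: less_imp_le)
  then have opt: "f xopt \<le> f xt" and feasible: "c xopt \<le> 0"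
    using xopt_optimal by (auto simp: is_arg_min_linorder feasible_set_def)
  have "projection_error_bound c \<rho>"
    using error_bound projection_error_bound_if_subgradients_bounded_below[OF c_convex z rho_pos]
    by blast
  then have "r \<le> positive_part (c xh) / \<rho>"
    by (simp add: projection_error_bound_def r_def xt_def)
  then have violation: "\<rho> * r \<le> positive_part (c xh)"
    using rho_pos by (simp add: field_simps)
  have "0 \<le> G"
    using f_lipschitz by (rule lipschitz_on_nonneg)
  then have lam: "0 \<le> lam"
    using lambda_gt rho_pos by (smt (verit) divide_nonneg_pos)
  have gap: "0 < lam * \<rho> - G"
    using lambda_gt rho_pos by (simp add: field_simps)
  have "lam * \<rho> * r \<le> lam * positive_part (c xh)"
    using mult_left_mono[OF violation lam] by (simp add: mult.assoc)
  moreover have "f xt - f xh \<le> G * r"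
    using lipschitz_onD[OF f_lipschitz, of xt xh] by (simp add: r_def dist_norm)
  moreover have "f xh + h \<gamma> xh - (f xopt + h \<gamma> xopt) \<le> B T \<gamma> xopt x1"
    using convergence T by (simp add: penalized_def xh_def)
  moreover have "lam * positive_part (c xh) \<le> h \<gamma> xh" and "h \<gamma> xopt \<le> C * \<gamma>"
    using h_lower h_upper feasible by auto
  ultimately have "f xt - f xopt \<le> D - (lam * \<rho> - G) * r"
    unfolding D_def by (simp add: left_diff_distrib)
  moreover have "0 \<le> (lam * \<rho> - G) * r"
    using gap by (simp add: r_def)
  ultimately have le: "f xt - f xopt \<le> D"
    by linarith
  \<comment> \<open>No sign of \<open>B\<close> is assumed: \<open>0 \<le> D\<close> follows because
    the feasible point \<open>xt\<close> cannot beat \<open>xopt\<close>. Since the factor is at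
    least 1, multiplying \<open>D\<close> by it only weakens the bound.\<close>
  with opt have "0 \<le> D"
    by linarith
  moreover have "1 \<le> lam * \<rho> / (lam * \<rho> - G)"
    using gap \<open>0 \<le> G\<close> by simp
  ultimately have "D \<le> lam * \<rho> / (lam * \<rho> - G) * D"
    using mult_right_mono by fastforce
  with le show "f (closest_point (feasible_set c) (run A (penalized f h \<gamma>) T x1)) - f xopt
      \<le> lam * \<rho> / (lam * \<rho> - G) * (C * \<gamma> + B T \<gamma> xopt x1)"
    unfolding xt_def xh_def D_def by linarith
qed

end
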